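(* Let $\xi_1,\xi_2,\ldots$ be independent nonnegative random variables, and let $\eta$ be a counting random variable independent of $\{\xi_1,\xi_2,\ldots\}$. Suppose that the following conditions are satisfied: (a) $F_{\xi_1}\in\mathcal{C}$; (b) for each $k\geqslant2$, either $F_{\xi_k}\in\mathcal{C}$ or $\overline{F}_{\xi_k}(x)=o\left(\overline{F}_{\xi_1}(x)\right)$ as $x\to\infty$; (c) $\mathbb{E}\,\xi_1<\infty$; (d) $\overline{F}_{\eta}(x)=o\left(\overline{F}_{\xi_1}(x)\right)$ as $x\to\infty$; (e) $\displaystyle\limsup_{x\to\infty}\,\sup_{n\geqslant1}\frac{1}{n\,\overline{F}_{\xi_1}(x)}\sum_{i=1}^{n}\overline{F}_{\xi_i}(x)<\infty$; (f) $\displaystyle\limsup_{u\to\infty}\,\sup_{n\geqslant1}\frac{1}{n}\sum_{\substack{1\leqslant k\leqslant n\\ \mathbb{E}\xi_k\geqslant u}}\mathbb{E}\,\xi_k=0$. Then the distribution function $F_{S_\eta}$ of the randomly stopped sum $S_\eta$ belongs to the class $\mathcal{C}$.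
   Context: For a random variable $X$, $F_X(x)=\mathbb{P}(X\leqslant x)$ denotes its distribution function (d.f.), and for a d.f. $F$, $\overline{F}(x)=1-F(x)$ for real $x$. A counting random variable is an integer-valued, nonnegative random variable that is nondegenerate at zero (i.e. $\mathbb{P}(\eta=0)<1$). Put $S_0=0$, $S_n=\xi_1+\cdots+\xi_n$ for $n\in\mathbb{N}$, and $S_\eta=\sum_{k=1}^{\eta}\xi_k$, so that $F_{S_\eta}(x)=\sum_{n=0}^{\infty}\mathbb{P}(\eta=n)\mathbb{P}(S_n\leqslant x)$. Class $\mathcal{C}$: a d.f. $F$ on $\mathbb{R}$ (with $\overline{F}(x)>0$ for all $x$, so that the ratio is defined) has a consistently varying tail, written $F\in\mathcal{C}$, if $$\lim_{y\uparrow1}\limsup_{x\to\infty}\frac{\overline{F}(xy)}{\overline{F}(x)}=1.$$ The notation $f(x)=o(g(x))$ means $\lim_{x\to\infty}f(x)/g(x)=0$. *)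

theory Defs
  imports "HOL-Probability.Probability"
begin

definition df :: "'a measure \<Rightarrow> ('a \<Rightarrow> real) \<Rightarrow> real \<Rightarrow> real" where
  "df M X = cdf (distr M borel X)"

definition tail :: "(real \<Rightarrow> real) \<Rightarrow> real \<Rightarrow> real" where
  "tail F x = 1 - F x"

text \<open>The upper limit is taken in the extended reals, since it may a priori be infinite.\<close>

definition consistently_varying :: "(real \<Rightarrow> real) set" where
  "consistently_varying =
    {F. (\<exists>N. real_distribution N \<and> F = cdf N) \<and>
        (\<forall>x. tail F x > 0) \<and>
        ((\<lambda>y. Limsup at_top (\<lambda>x. ereal (tail F (x * y) / tail F x))) \<longlongrightarrow> 1) (at_left 1)}"

text \<open>
  Expectation of a nonnegative random variable, possibly infinite. The Bochner integral would
  be unsuitable here because it is zero for non-integrable functions.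
\<close>

definition mean :: "'a measure \<Rightarrow> ('a \<Rightarrow> real) \<Rightarrow> ennreal" where
  "mean M X = (\<integral>\<^sup>+ \<omega>. ennreal (X \<omega>) \<partial>M)"

text \<open>
  Independence of two random elements with values in possibly different types;
  \<^const>\<open>prob_space.indep_var\<close> requires both to have the same type.
\<close>

definition indep_elements ::
  "'a measure \<Rightarrow> 'b measure \<Rightarrow> ('a \<Rightarrow> 'b) \<Rightarrow> 'c measure \<Rightarrow> ('a \<Rightarrow> 'c) \<Rightarrow> bool" where
  "indep_elements M N Y N' Z \<longleftrightarrow>
    Y \<in> measurable M N \<and> Z \<in> measurable M N' \<and>
    prob_space.indep_set M
      {Y -` A \<inter> space M | A. A \<in> sets N}
      {Z -` B \<inter> space M | B. B \<in> sets N'}"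

definition counting_rv :: "'a measure \<Rightarrow> ('a \<Rightarrow> nat) \<Rightarrow> bool" where
  "counting_rv M \<eta> \<longleftrightarrow>
    \<eta> \<in> measurable M (count_space UNIV) \<and> measure M {\<omega> \<in> space M. \<eta> \<omega> = 0} < 1"

text \<open>Sequences of summands are indexed from 1; the value at index 0 is ignored.\<close>

definition partial_sum :: "(nat \<Rightarrow> 'a \<Rightarrow> real) \<Rightarrow> nat \<Rightarrow> 'a \<Rightarrow> real" where
  "partial_sum \<xi> n \<omega> = (\<Sum>k=1..n. \<xi> k \<omega>)"

definition stopped_sum :: "(nat \<Rightarrow> 'a \<Rightarrow> real) \<Rightarrow> ('a \<Rightarrow> nat) \<Rightarrow> 'a \<Rightarrow> real" where
  "stopped_sum \<xi> \<eta> \<omega> = partial_sum \<xi> (\<eta> \<omega>) \<omega>"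

end

theory Submission
  imports Defs "HOL-Library.Landau_Symbols"
begin

text \<open>
  Write \<open>T\<close> for the tail of \<open>\<xi> 1\<close>, \<open>G n\<close> for the tail of the partial sum of \<open>n\<close> terms and \<open>p n\<close> for the
  probability that \<open>\<eta> = n\<close>. By independence the tail of the stopped sum is the mixture \<open>\<Sum>n. p n * G n\<close>.
  Everything is measured against \<open>T\<close>: call \<open>g\<close> scale continuous relative to \<open>T\<close> if for every \<open>\<epsilon> > 0\<close>
  and all \<open>y < 1\<close> close enough to 1, \<open>g (x y) - g x \<le> \<epsilon> T x\<close> for all large \<open>x\<close>. A positive tail is consistently
  varying iff it is scale continuous relative to itself. The relative notion has three advantages. Both
  alternatives in hypothesis (b) imply it, because (e) makes the tail of each \<open>\<xi> k\<close> an \<open>O(T)\<close>. It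
  is additive, so that finite sums of tails inherit it. And any remainder of size \<open>\<epsilon> T\<close> is harmless. It
  can be converted back at the end, as the tail of the stopped sum is at least the probability of
  \<open>\<eta> > 0\<close> times \<open>T\<close>.

  For each fixed \<open>n\<close>, \<open>G n\<close> is scale continuous relative to \<open>T\<close> by induction on \<open>n\<close>: the tail of a
  sum of two independent terms is the sum of their tails up to a product of tails, which is \<open>o(T)\<close>
  (scale_continuous_add_tail). It remains to show that the part of the mixture with \<open>n \<ge> K\<close> is at most
  \<open>\<epsilon> T x\<close> for some \<open>K\<close> and all large \<open>x\<close>.

  For this, (f) gives a linear bound \<open>\<mu> n\<close> on the mean of the partial sums, and truncation together with
  a Chernoff bound yields, for every order \<open>q\<close>,
  \<open>G n x \<le> (\<Sum>k=1..n. tail of \<xi> k at x / q) + exp (q \<mu>) (n / x) ^ q\<close> (tail_sum_le_tails_plus_power).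
  By (e) and the bounded growth of \<open>T\<close> under scaling, the first term is a constant times \<open>n T x\<close>;
  summed against \<open>p n\<close> over \<open>n \<ge> K\<close> it is small relative to \<open>T x\<close> because \<open>\<eta>\<close> has a finite mean,
  by (c) and (d). The contribution of the second term is a truncated moment of \<open>\<eta>\<close>. It is negligible
  against \<open>T x\<close> as soon as \<open>2 ^ q\<close> exceeds twice the factor by which \<open>T\<close> may grow when its argument is
  halved (truncated_moment_le_tail).
\<close>

section \<open>Consistent variation as continuity on the multiplicative scale\<close>

text \<open>
  The reference function \<open>h\<close> is kept separate from \<open>g\<close> so that the property is additive in \<open>g\<close> and
  also covers functions that are negligible against \<open>h\<close>, including those that vanish.
\<close>

definition scale_continuous :: "(real \<Rightarrow> real) \<Rightarrow> (real \<Rightarrow> real) \<Rightarrow> bool" where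
  "scale_continuous h g \<longleftrightarrow>
    (\<forall>\<epsilon>>0. \<forall>\<^sub>F y in at_left 1. \<forall>\<^sub>F x in at_top. g (x * y) \<le> g x + \<epsilon> * h x)"

lemma eventually_at_left_1_Ioo: "\<forall>\<^sub>F y in at_left (1::real). 0 < y \<and> y < 1"
  unfolding eventually_at_left_field by (intro exI[of _ 0]) auto

lemma Limsup_ratio_tendsto_1_iff_scale_continuous:
  fixes g :: "real \<Rightarrow> real"
  assumes "antimono g" and pos: "\<And>x. g x > 0"
  shows "((\<lambda>y. Limsup at_top (\<lambda>x. ereal (g (x * y) / g x))) \<longlongrightarrow> 1) (at_left 1)
    \<longleftrightarrow> scale_continuous g g"
proof
  assume lim: "((\<lambda>y. Limsup at_top (\<lambda>x. ereal (g (x * y) / g x))) \<longlongrightarrow> 1) (at_left 1)"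
  show "scale_continuous g g"
    unfolding scale_continuous_def
  proof (intro allI impI)
    fix \<epsilon> :: real assume "\<epsilon> > 0"
    then have "1 < ereal (1 + \<epsilon>)" by simp
    from order_tendstoD(2)[OF lim this]
    show "\<forall>\<^sub>F y in at_left 1. \<forall>\<^sub>F x in at_top. g (x * y) \<le> g x + \<epsilon> * g x"
    proof eventually_elim
      case (elim y)
      from Limsup_lessD[OF elim] show ?case
        by eventually_elim (use pos in \<open>simp add: divide_less_eq algebra_simps less_imp_le\<close>)
    qed
  qed
next
  assume sc: "scale_continuous g g"
  show "((\<lambda>y. Limsup at_top (\<lambda>x. ereal (g (x * y) / g x))) \<longlongrightarrow> 1) (at_left 1)"
  proof (rule order_tendstoI)
    fix a :: ereal assume "a < 1"
    from eventually_at_left_1_Ioo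
    show "\<forall>\<^sub>F y in at_left 1. a < Limsup at_top (\<lambda>x. ereal (g (x * y) / g x))"
    proof eventually_elim
      case (elim y)
      have "\<forall>\<^sub>F x in at_top. 1 \<le> ereal (g (x * y) / g x)"
        using eventually_gt_at_top[of 0]
      proof eventually_elim
        case (elim x)
        with \<open>0 < y \<and> y < 1\<close> have "g x \<le> g (x * y)"
          by (intro antimonoD[OF \<open>antimono g\<close>]) (simp add: mult_le_cancel_left2)
        with pos[of x] show ?case by (simp add: le_divide_eq one_ereal_def)
      qed
      then have "1 \<le> Limsup at_top (\<lambda>x. ereal (g (x * y) / g x))"
        by (intro le_Limsup) simp_all
      with \<open>a < 1\<close> show ?case by (rule less_le_trans)
    qed
  next
    fix a :: ereal assume "1 < a"
    then obtain r where r: "1 < ereal r" "ereal r < a" using ereal_dense2 by blast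
    then have "r - 1 > 0" by simp
    with sc have "\<forall>\<^sub>F y in at_left 1. \<forall>\<^sub>F x in at_top. g (x * y) \<le> g x + (r - 1) * g x"
      unfolding scale_continuous_def by blast
    then show "\<forall>\<^sub>F y in at_left 1. Limsup at_top (\<lambda>x. ereal (g (x * y) / g x)) < a"
    proof eventually_elim
      case (elim y)
      then have "\<forall>\<^sub>F x in at_top. ereal (g (x * y) / g x) \<le> ereal r"
        by eventually_elim (use pos in \<open>simp add: divide_le_eq algebra_simps\<close>)
      then have "Limsup at_top (\<lambda>x. ereal (g (x * y) / g x)) \<le> ereal r"
        by (rule Limsup_bounded)
      with r show ?case by simp
    qed
  qed
qed

lemma scale_continuous_bigo:
  assumes sc: "scale_continuous h g" and O: "h \<in> O[at_top](h')"
    and nonneg: "\<And>x. h x \<ge> 0" "\<And>x. h' x \<ge> 0"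
  shows "scale_continuous h' g"
  unfolding scale_continuous_def
proof (intro allI impI)
  fix \<epsilon> :: real assume "\<epsilon> > 0"
  from landau_o.bigE[OF O] obtain C
    where "C > 0" and C: "\<forall>\<^sub>F x in at_top. norm (h x) \<le> C * norm (h' x)" by blast
  then have "\<epsilon> / C > 0" using \<open>\<epsilon> > 0\<close> by simp
  with sc have "\<forall>\<^sub>F y in at_left 1. \<forall>\<^sub>F x in at_top. g (x * y) \<le> g x + \<epsilon> / C * h x"
    unfolding scale_continuous_def by blast
  then show "\<forall>\<^sub>F y in at_left 1. \<forall>\<^sub>F x in at_top. g (x * y) \<le> g x + \<epsilon> * h' x"
  proof eventually_elim
    case (elim y)
    from elim C show ?case
    proof eventually_elim
      case (elim x)
      have "\<epsilon> / C * h x \<le> \<epsilon> / C * (C * h' x)"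
        using elim(2) nonneg \<open>\<epsilon> / C > 0\<close> by (intro mult_left_mono) auto
      with elim(1) \<open>C > 0\<close> show ?case by simp
    qed
  qed
qed

lemma scale_continuous_smallo:
  assumes small: "g \<in> o[at_top](h)" and nonneg: "\<And>x. g x \<ge> 0"
    and h: "\<And>x. h x > 0" "scale_continuous h h"
  shows "scale_continuous h g"
  unfolding scale_continuous_def
proof (intro allI impI)
  fix \<epsilon> :: real assume "\<epsilon> > 0"
  then have "\<epsilon> / 2 > 0" by simp
  from landau_o.smallD[OF small this]
  have g_le: "\<forall>\<^sub>F x in at_top. g x \<le> \<epsilon> / 2 * h x"
    by eventually_elim (use h nonneg in \<open>simp add: less_imp_le\<close>)
  from h(2) have "\<forall>\<^sub>F y in at_left 1. \<forall>\<^sub>F x in at_top. h (x * y) \<le> h x + 1 * h x"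
    unfolding scale_continuous_def using zero_less_one by blast
  with eventually_at_left_1_Ioo
  show "\<forall>\<^sub>F y in at_left 1. \<forall>\<^sub>F x in at_top. g (x * y) \<le> g x + \<epsilon> * h x"
  proof eventually_elim
    case (elim y)
    have "filterlim (\<lambda>x. x * y) at_top at_top"
      using elim by (intro filterlim_at_top_mult_tendsto_pos[OF tendsto_const] filterlim_ident) simp
    from eventually_compose_filterlim[OF g_le this] elim(2) show ?case
    proof eventually_elim
      case (elim x)
      have "\<epsilon> / 2 * h (x * y) \<le> \<epsilon> / 2 * (h x + 1 * h x)"
        using elim(2) \<open>\<epsilon> > 0\<close> by (intro mult_left_mono) auto
      with elim(1) nonneg[of x] show ?case by simp
    qed
  qed
qed

text \<open>
  Continuity at a single factor \<open>y < 1\<close> gives \<open>h (x y) \<le> 2 h x\<close>; iterating this controls any scaling of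
  the argument.
\<close>

lemma scale_continuous_imp_bigo_scaled:
  assumes "antimono h" and pos: "\<And>x. h x > 0" and sc: "scale_continuous h h" and "c > 0"
  shows "(\<lambda>x. h (c * x)) \<in> O[at_top](h)"
proof -
  from sc have "\<forall>\<^sub>F y in at_left 1. \<forall>\<^sub>F x in at_top. h (x * y) \<le> h x + 1 * h x"
    unfolding scale_continuous_def using zero_less_one by blast
  with eventually_at_left_1_Ioo
  have "\<forall>\<^sub>F y in at_left 1. (0 < y \<and> y < 1) \<and> (\<forall>\<^sub>F x in at_top. h (x * y) \<le> h x + 1 * h x)"
    by (rule eventually_conj)
  then obtain y where y: "0 < y" "y < 1" and ev: "\<forall>\<^sub>F x in at_top. h (x * y) \<le> 2 * h x"
    using eventually_happens[of _ "at_left (1::real)"] by auto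
  have iter: "\<forall>\<^sub>F x in at_top. h (x * y ^ m) \<le> 2 ^ m * h x" for m
  proof (induction m)
    case (Suc m)
    have "filterlim (\<lambda>x. x * y ^ m) at_top at_top"
      using y by (intro filterlim_at_top_mult_tendsto_pos[OF tendsto_const] filterlim_ident) simp
    from eventually_compose_filterlim[OF ev this] Suc show ?case
      by eventually_elim (simp add: mult_ac)
  qed simp
  obtain m where m: "y ^ m < c" using real_arch_pow_inv[of c y] y \<open>c > 0\<close> by auto
  show ?thesis
  proof (rule bigoI)
    show "\<forall>\<^sub>F x in at_top. norm (h (c * x)) \<le> 2 ^ m * norm (h x)"
      using iter[of m] eventually_gt_at_top[of 0]
    proof eventually_elim
      case (elim x)
      have "h (c * x) \<le> h (x * y ^ m)"
        using m elim by (intro antimonoD[OF \<open>antimono h\<close>]) (simp add: mult.commute)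
      with elim pos[of "c * x"] pos[of x] show ?case by simp
    qed
  qed
qed

section \<open>Tails of random variables\<close>

lemma (in prob_space) tail_df_eq_prob:
  assumes "random_variable borel X"
  shows "tail (df M X) x = prob {\<omega> \<in> space M. X \<omega> > x}"
proof -
  have [measurable]: "X \<in> borel_measurable M" by fact
  have "df M X x = prob {\<omega> \<in> space M. X \<omega> \<le> x}"
    unfolding df_def cdf_def
    by (subst measure_distr) (auto intro!: arg_cong[where f=prob])
  moreover have "prob {\<omega> \<in> space M. \<not> X \<omega> \<le> x} = 1 - prob {\<omega> \<in> space M. X \<omega> \<le> x}"
    by (intro prob_neg) measurable
  ultimately show ?thesis by (simp add: tail_def not_le)
qed

lemma (in prob_space) antimono_tail_df:
  assumes "random_variable borel X"
  shows "antimono (tail (df M X))"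
proof (rule antimonoI)
  fix x y :: real assume "x \<le> y"
  have [measurable]: "X \<in> borel_measurable M" by fact
  show "tail (df M X) y \<le> tail (df M X) x"
    unfolding tail_df_eq_prob[OF assms] using \<open>x \<le> y\<close> by (intro finite_measure_mono) auto
qed

lemma (in prob_space) tail_df_nonneg:
  assumes "random_variable borel X"
  shows "0 \<le> tail (df M X) x" "tail (df M X) x \<le> 1"
  unfolding tail_df_eq_prob[OF assms] by simp_all

lemma (in prob_space) tail_df_tendsto_0:
  assumes "random_variable borel X"
  shows "(tail (df M X) \<longlongrightarrow> 0) at_top"
proof -
  interpret N: real_distribution "distr M borel X" using assms by (rule real_distribution_distr)
  from tendsto_diff[OF tendsto_const[of 1] N.cdf_lim_at_top_prob] show ?thesis
    by (simp add: tail_def[abs_def] df_def)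
qed

lemma (in prob_space) consistently_varying_iff:
  assumes "random_variable borel X"
  shows "df M X \<in> consistently_varying \<longleftrightarrow>
    (\<forall>x. tail (df M X) x > 0) \<and> scale_continuous (tail (df M X)) (tail (df M X))"
proof -
  have "real_distribution (distr M borel X)" using assms by (rule real_distribution_distr)
  then have "\<exists>N. real_distribution N \<and> df M X = cdf N" unfolding df_def by blast
  then show ?thesis
    unfolding consistently_varying_def
    using Limsup_ratio_tendsto_1_iff_scale_continuous[OF antimono_tail_df[OF assms]] by blast
qed

section \<open>Sums of two independent random variables\<close>

lemma (in prob_space) prob_both_greater:
  fixes X Y :: "'a \<Rightarrow> real"
  assumes "indep_var borel X borel Y"
  shows "prob ({\<omega> \<in> space M. X \<omega> > a} \<inter> {\<omega> \<in> space M. Y \<omega> > b}) =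
    prob {\<omega> \<in> space M. X \<omega> > a} * prob {\<omega> \<in> space M. Y \<omega> > b}"
proof -
  have eq: "X -` {a<..} \<inter> space M = {\<omega> \<in> space M. X \<omega> > a}"
    "Y -` {b<..} \<inter> space M = {\<omega> \<in> space M. Y \<omega> > b}"
    "(\<lambda>\<omega>. (X \<omega>, Y \<omega>)) -` ({a<..} \<times> {b<..}) \<inter> space M =
      {\<omega> \<in> space M. X \<omega> > a} \<inter> {\<omega> \<in> space M. Y \<omega> > b}" by auto
  show ?thesis using indep_varD[OF assms, of "{a<..}" "{b<..}"] by (simp only: eq) simp
qed

text \<open>
  The principle of a single big jump: if \<open>X + Y > x\<close> although neither summand exceeds the fraction
  \<open>z x\<close>, then both summands exceed \<open>(1 - z) x\<close>. When scaling changes the tails only by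
  bounded factors, the product is of smaller order than either tail.
\<close>

lemma tail_sum_upper:
  fixes z :: real assumes "prob_space M" "prob_space.indep_var M borel X borel Y"
  shows "tail (df M (\<lambda>\<omega>. X \<omega> + Y \<omega>)) x \<le> tail (df M X) (z * x) + tail (df M Y) (z * x)
    + tail (df M X) ((1 - z) * x) * tail (df M Y) ((1 - z) * x)"
proof -
  interpret prob_space M by fact
  have X: "random_variable borel X" and Y: "random_variable borel Y"
    using assms(2) indep_var_rv1 indep_var_rv2 by auto
  note [measurable] = X Y
  have XY: "random_variable borel (\<lambda>\<omega>. X \<omega> + Y \<omega>)" by measurable
  let ?A = "{\<omega> \<in> space M. X \<omega> > z * x}" and ?B = "{\<omega> \<in> space M. Y \<omega> > z * x}"
  let ?C = "{\<omega> \<in> space M. X \<omega> > (1 - z) * x}" and ?D = "{\<omega> \<in> space M. Y \<omega> > (1 - z) * x}"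
  have "{\<omega> \<in> space M. X \<omega> + Y \<omega> > x} \<subseteq> (?A \<union> ?B) \<union> (?C \<inter> ?D)"
    by (auto simp: algebra_simps)
  then have "prob {\<omega> \<in> space M. X \<omega> + Y \<omega> > x} \<le> prob ((?A \<union> ?B) \<union> (?C \<inter> ?D))"
    by (intro finite_measure_mono) auto
  also have "\<dots> \<le> prob (?A \<union> ?B) + prob (?C \<inter> ?D)" by (intro measure_Un_le) auto
  also have "prob (?A \<union> ?B) \<le> prob ?A + prob ?B" by (intro measure_Un_le) auto
  also have "prob (?C \<inter> ?D) = prob ?C * prob ?D"
    by (rule prob_both_greater[OF assms(2)])
  finally show ?thesis by (simp add: tail_df_eq_prob X Y XY)
qed

text \<open>
  For nonnegative summands the sum exceeds \<open>x\<close> as soon as one summand does; the product is the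
  probability that both do.
\<close>

lemma tail_sum_lower:
  assumes "prob_space M" "prob_space.indep_var M borel X borel Y"
    and nonneg: "\<And>\<omega>. \<omega> \<in> space M \<Longrightarrow> 0 \<le> X \<omega>" "\<And>\<omega>. \<omega> \<in> space M \<Longrightarrow> 0 \<le> Y \<omega>"
  shows "tail (df M X) x + tail (df M Y) x \<le> tail (df M (\<lambda>\<omega>. X \<omega> + Y \<omega>)) x
    + tail (df M X) x * tail (df M Y) x"
proof -
  interpret prob_space M by fact
  have X: "random_variable borel X" and Y: "random_variable borel Y"
    using assms(2) indep_var_rv1 indep_var_rv2 by auto
  note [measurable] = X Y
  have XY: "random_variable borel (\<lambda>\<omega>. X \<omega> + Y \<omega>)" by measurable
  let ?A = "{\<omega> \<in> space M. X \<omega> > x}" and ?B = "{\<omega> \<in> space M. Y \<omega> > x}"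
  have "?A \<union> ?B \<subseteq> {\<omega> \<in> space M. X \<omega> + Y \<omega> > x}"
    using nonneg by (auto intro: less_le_trans)
  then have "prob (?A \<union> ?B) \<le> prob {\<omega> \<in> space M. X \<omega> + Y \<omega> > x}"
    by (intro finite_measure_mono) auto
  moreover have "prob ?A + prob ?B = prob (?A \<union> ?B) + prob (?A \<inter> ?B)"
    by (simp add: finite_measure_Union' finite_measure_Diff' Int_commute)
  moreover have "prob (?A \<inter> ?B) = prob ?A * prob ?B"
    by (rule prob_both_greater[OF assms(2)])
  ultimately show ?thesis by (simp add: tail_df_eq_prob X Y XY)
qed

text \<open>
  The two bounds above, taken at the levels \<open>x y\<close> and \<open>x\<close> with the fraction \<open>z = y\<close>, compare the tail of
  the sum with itself: the summands are then evaluated at \<open>x y\<^sup>2\<close> and at \<open>x\<close>, which their own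
  continuity controls, and the product terms are small because one factor is \<open>O(h)\<close> while the other
  tends to 0.
\<close>

lemma scale_continuous_add_tail:
  assumes M: "prob_space M" and ind: "prob_space.indep_var M borel X borel Y"
    and nonneg: "\<And>\<omega>. \<omega> \<in> space M \<Longrightarrow> 0 \<le> X \<omega>" "\<And>\<omega>. \<omega> \<in> space M \<Longrightarrow> 0 \<le> Y \<omega>"
    and h: "\<And>x. h x > 0" "\<And>c. c > 0 \<Longrightarrow> (\<lambda>x. h (c * x)) \<in> O[at_top](h)"
    and O: "tail (df M X) \<in> O[at_top](h)" "tail (df M Y) \<in> O[at_top](h)"
    and sc: "scale_continuous h (tail (df M X))" "scale_continuous h (tail (df M Y))"
  shows "scale_continuous h (tail (df M (\<lambda>\<omega>. X \<omega> + Y \<omega>)))"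
    and "tail (df M (\<lambda>\<omega>. X \<omega> + Y \<omega>)) \<in> O[at_top](h)"
proof -
  interpret prob_space M by fact
  have X: "random_variable borel X" and Y: "random_variable borel Y"
    using ind indep_var_rv1 indep_var_rv2 by auto
  note [measurable] = X Y
  have XY: "random_variable borel (\<lambda>\<omega>. X \<omega> + Y \<omega>)" by measurable
  let ?F = "tail (df M X)" and ?G = "tail (df M Y)" and ?H = "tail (df M (\<lambda>\<omega>. X \<omega> + Y \<omega>))"
  have scale: "filterlim (\<lambda>x. c * x) at_top at_top" if "c > 0" for c :: real
    using that by (intro filterlim_tendsto_pos_mult_at_top[OF tendsto_const] filterlim_ident)
  have O_scaled: "(\<lambda>x. T (c * x)) \<in> O[at_top](h)" if "c > 0" "T \<in> O[at_top](h)" for c T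
    using landau_o.big_trans[OF landau_o.big.compose[OF that(2) scale[OF that(1)]] h(2)[OF that(1)]] .
  have prod_small: "(\<lambda>x. ?F (c * x) * ?G (c * x)) \<in> o[at_top](h)" if "c > 0" for c
  proof -
    have "((\<lambda>x. ?G (c * x)) \<longlongrightarrow> 0) at_top"
      using filterlim_compose[OF tail_df_tendsto_0[OF Y] scale[OF that]] .
    then have "(\<lambda>x. ?G (c * x)) \<in> o[at_top](\<lambda>_. 1)" by (intro smalloI_tendsto) auto
    from landau_o.big_small_mult[OF O_scaled[OF that O(1)] this] show ?thesis by simp
  qed
  show "?H \<in> O[at_top](h)"
  proof -
    have half: "1 / 2 > (0 :: real)" by simp
    have O3: "(\<lambda>x. ?F (1 / 2 * x) + ?G (1 / 2 * x) + ?F (1 / 2 * x) * ?G (1 / 2 * x)) \<in> O[at_top](h)"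
      by (rule sum_in_bigo(1)[OF sum_in_bigo(1)[OF O_scaled[OF half O(1)] O_scaled[OF half O(2)]]
            landau_o.small_imp_big[OF prod_small[OF half]]])
    have "\<forall>\<^sub>F x in at_top. norm (?H x) \<le>
        1 * norm (?F (1 / 2 * x) + ?G (1 / 2 * x) + ?F (1 / 2 * x) * ?G (1 / 2 * x))"
    proof (intro always_eventually allI)
      fix x
      have "?H x \<le> ?F (1 / 2 * x) + ?G (1 / 2 * x) + ?F (1 / 2 * x) * ?G (1 / 2 * x)"
        using tail_sum_upper[OF M ind, of x "1 / 2"] by simp
      then show "norm (?H x) \<le>
        1 * norm (?F (1 / 2 * x) + ?G (1 / 2 * x) + ?F (1 / 2 * x) * ?G (1 / 2 * x))"
        using tail_df_nonneg(1)[OF XY, of x] by simp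
    qed
    from landau_o.big_trans[OF bigoI[OF this] O3] show ?thesis .
  qed
  show "scale_continuous h ?H"
    unfolding scale_continuous_def
  proof (intro allI impI)
    fix \<epsilon> :: real assume "\<epsilon> > 0"
    then have e: "\<epsilon> / 4 > 0" by simp
    \<comment> \<open>the summands are needed at \<open>x y\<^sup>2\<close>: one factor \<open>y\<close> from the level, one from the fraction\<close>
    have sq: "filterlim (\<lambda>y::real. y * y) (at_left 1) (at_left 1)"
    proof (rule filterlim_at_withinI)
      show "((\<lambda>y::real. y * y) \<longlongrightarrow> 1) (at_left 1)"
        by (rule tendsto_eq_intros refl | simp)+
      show "\<forall>\<^sub>F y::real in at_left 1. y * y \<in> {..<1} - {1}"
        using eventually_at_left_1_Ioo
      proof eventually_elim
        case (elim y)
        then show ?case using mult_strict_mono[of y 1 y 1] by simp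
      qed
    qed
    have "\<forall>\<^sub>F y in at_left 1. \<forall>\<^sub>F x in at_top. T (x * (y * y)) \<le> T x + \<epsilon> / 4 * h x"
      if "scale_continuous h T" for T
      using that e unfolding scale_continuous_def
      by (intro eventually_compose_filterlim[OF _ sq]) blast
    from eventually_at_left_1_Ioo this[OF sc(1)] this[OF sc(2)]
    show "\<forall>\<^sub>F y in at_left 1. \<forall>\<^sub>F x in at_top. ?H (x * y) \<le> ?H x + \<epsilon> * h x"
    proof eventually_elim
      case (elim y)
      have "(1 - y) * y > 0" using elim by simp
      from landau_o.smallD[OF prod_small[OF this] e] landau_o.smallD[OF prod_small[OF zero_less_one] e] elim(2,3)
      show ?case
      proof eventually_elim
        case (elim x)
        have "?H (x * y) \<le> ?F (y * (x * y)) + ?G (y * (x * y))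
            + ?F ((1 - y) * (x * y)) * ?G ((1 - y) * (x * y))"
          by (rule tail_sum_upper[OF M ind])
        also have "\<dots> = ?F (x * (y * y)) + ?G (x * (y * y))
            + ?F ((1 - y) * y * x) * ?G ((1 - y) * y * x)"
          by (simp add: mult_ac)
        also have "\<dots> \<le> (?F x + \<epsilon> / 4 * h x) + (?G x + \<epsilon> / 4 * h x) + \<epsilon> / 4 * h x"
          using elim(1) h(1)[of x] by (intro add_mono elim(3,4)) simp
        also have "\<dots> = (?F x + ?G x) + 3 * (\<epsilon> / 4 * h x)" by simp
        also have "?F x + ?G x \<le> ?H x + ?F x * ?G x" by (rule tail_sum_lower[OF M ind nonneg])
        also have "?F x * ?G x \<le> \<epsilon> / 4 * h x" using elim(2) h(1)[of x] by simp
        finally show ?case by simp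
      qed
    qed
  qed
qed

section \<open>Sums of many independent random variables\<close>

lemma exp_le_chord:
  fixes s b x :: real
  assumes "0 \<le> x" "x \<le> b" "0 < b"
  shows "exp (s * x) \<le> 1 + x / b * (exp (s * b) - 1)"
proof -
  have "convex_on UNIV exp" by (rule exp_convex)
  from convex_onD[OF this, of "x / b" 0 "s * b"] assms
  have "exp (x / b * (s * b)) \<le> (1 - x / b) * exp 0 + x / b * exp (s * b)" by simp
  also have "x / b * (s * b) = s * x" using assms by simp
  finally show ?thesis by (simp add: algebra_simps)
qed

text \<open>
  A Chernoff bound in which convexity of the exponential replaces each moment generating function by
  an expression in the mean of the summand and the common upper bound \<open>b\<close>.
\<close>

lemma (in prob_space) prob_bounded_sum_ge_le:
  fixes X :: "'i \<Rightarrow> 'a \<Rightarrow> real"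
  assumes fin: "finite I" and ind: "indep_vars (\<lambda>_. borel) X I"
    and bounds: "\<And>i \<omega>. i \<in> I \<Longrightarrow> \<omega> \<in> space M \<Longrightarrow> 0 \<le> X i \<omega> \<and> X i \<omega> \<le> b"
    and b: "b > 0" and s: "s > 0"
  shows "prob {\<omega> \<in> space M. (\<Sum>i\<in>I. X i \<omega>) \<ge> x} \<le>
    exp (- s * x) * exp ((exp (s * b) - 1) / b * (\<Sum>i\<in>I. expectation (X i)))"
proof -
  have meas[measurable]: "X i \<in> borel_measurable M" if "i \<in> I" for i
    using ind that by (auto simp: indep_vars_def)
  define a where "a = (exp (s * b) - 1) / b"
  have "a \<ge> 0" using b s by (simp add: a_def)
  have indE: "indep_vars (\<lambda>_. borel) (\<lambda>i \<omega>. exp (s * X i \<omega>)) I"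
    by (rule indep_vars_compose2[OF ind]) measurable
  have intX: "integrable M (X i)" if "i \<in> I" for i
    using bounds[OF that] that
    by (intro integrable_const_bound[of _ b]) auto
  have intE: "integrable M (\<lambda>\<omega>. exp (s * X i \<omega>))" if "i \<in> I" for i
    using bounds[OF that] that s
    by (intro integrable_const_bound[of _ "exp (s * b)"]) auto
  have E_le: "expectation (\<lambda>\<omega>. exp (s * X i \<omega>)) \<le> exp (a * expectation (X i))" if "i \<in> I" for i
  proof -
    have "exp (s * X i \<omega>) \<le> 1 + a * X i \<omega>" if "\<omega> \<in> space M" for \<omega>
      using exp_le_chord[of "X i \<omega>" b s] bounds[OF \<open>i \<in> I\<close> that] b
      by (simp add: a_def mult.commute)
    then have "expectation (\<lambda>\<omega>. exp (s * X i \<omega>)) \<le> expectation (\<lambda>\<omega>. 1 + a * X i \<omega>)"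
      using intE[OF that] intX[OF that] by (intro integral_mono) auto
    also have "\<dots> = 1 + a * expectation (X i)" using intX[OF that] by (simp add: prob_space)
    also have "\<dots> \<le> exp (a * expectation (X i))" by (rule exp_ge_add_one_self)
    finally show ?thesis .
  qed
  have int_prod: "integrable M (\<lambda>\<omega>. \<Prod>i\<in>I. exp (s * X i \<omega>))"
    by (rule indep_vars_integrable[OF fin indE intE])
  have eq: "exp (s * (\<Sum>i\<in>I. X i \<omega>)) = (\<Prod>i\<in>I. exp (s * X i \<omega>))" for \<omega>
    by (simp add: sum_distrib_left exp_sum fin)
  have "set_integrable M (space M) (\<lambda>\<omega>. exp (s * (\<Sum>i\<in>I. X i \<omega>)))"
    unfolding set_integrable_def eq by (rule integrable_mult_indicator[OF sets.top int_prod])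
  then have "prob {\<omega> \<in> space M. (\<Sum>i\<in>I. X i \<omega>) \<ge> x} \<le>
      exp (- s * x) * (\<integral>\<omega>\<in>space M. exp (s * (\<Sum>i\<in>I. X i \<omega>)) \<partial>M)"
    by (intro Chernoff_ineq_ge[OF s]) simp_all
  also have "(\<integral>\<omega>\<in>space M. exp (s * (\<Sum>i\<in>I. X i \<omega>)) \<partial>M) = expectation (\<lambda>\<omega>. \<Prod>i\<in>I. exp (s * X i \<omega>))"
    by (subst set_integral_space) (use int_prod in \<open>simp_all add: eq\<close>)
  also have "\<dots> = (\<Prod>i\<in>I. expectation (\<lambda>\<omega>. exp (s * X i \<omega>)))"
    by (rule indep_vars_lebesgue_integral[OF fin indE intE])
  also have "\<dots> \<le> (\<Prod>i\<in>I. exp (a * expectation (X i)))"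
    by (intro prod_mono conjI E_le integral_nonneg_AE) auto
  also have "\<dots> = exp (a * (\<Sum>i\<in>I. expectation (X i)))"
    by (simp add: exp_sum fin sum_distrib_left)
  finally show ?thesis by (simp add: a_def)
qed

text \<open>
  Either one summand exceeds \<open>x / q\<close>, or truncating all of them at the level \<open>b = x / q\<close> does not change
  the sum. To the truncated sum the Chernoff bound is applied with \<open>exp (s b) = 1 + x / n\<close>. With
  this choice the means contribute only the constant factor \<open>exp (q \<mu>)\<close>, and
  \<open>exp (- s x)\<close>, the inverse of \<open>(1 + x / n) ^ q\<close>, is at most \<open>(n / x) ^ q\<close>.
\<close>

lemma tail_sum_le_tails_plus_power:
  fixes X :: "nat \<Rightarrow> 'a \<Rightarrow> real"
  assumes M: "prob_space M" and ind: "prob_space.indep_vars M (\<lambda>_. borel) X {1..n}"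
    and nonneg: "\<And>k \<omega>. k \<in> {1..n} \<Longrightarrow> \<omega> \<in> space M \<Longrightarrow> 0 \<le> X k \<omega>"
    and mean: "(\<Sum>k=1..n. mean M (X k)) \<le> ennreal (\<mu> * n)" and "\<mu> \<ge> 0"
    and q: "q \<ge> 1" and n: "n \<ge> 1" and x: "x > 0"
  shows "tail (df M (\<lambda>\<omega>. \<Sum>k=1..n. X k \<omega>)) x \<le>
    (\<Sum>k=1..n. tail (df M (X k)) (1 / q * x)) + exp (q * \<mu>) * (n / x) ^ q"
proof -
  interpret prob_space M by fact
  have meas[measurable]: "X k \<in> borel_measurable M" if "k \<in> {1..n}" for k
    using ind that by (auto simp: indep_vars_def)
  define b where "b = x / q"
  have b: "b > 0" using q x by (simp add: b_def)
  let ?Y = "\<lambda>k \<omega>. min (X k \<omega>) b"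
  have measS: "random_variable borel (\<lambda>\<omega>. \<Sum>k=1..n. X k \<omega>)" by measurable
  have indY: "indep_vars (\<lambda>_. borel) ?Y {1..n}" by (rule indep_vars_compose2[OF ind]) measurable
  have intY: "integrable M (?Y k)" if "k \<in> {1..n}" for k
    using nonneg[OF that] that b by (intro integrable_const_bound[of _ b]) auto
  have sum_mean: "(\<Sum>k=1..n. expectation (?Y k)) \<le> \<mu> * n"
  proof -
    have "ennreal (\<Sum>k=1..n. expectation (?Y k)) = (\<Sum>k=1..n. ennreal (expectation (?Y k)))"
      using nonneg b by (intro sum_ennreal[symmetric] integral_nonneg_AE) auto
    also have "\<dots> \<le> (\<Sum>k=1..n. mean M (X k))"
    proof (rule sum_mono)
      fix k assume k: "k \<in> {1..n}"
      have "ennreal (expectation (?Y k)) = (\<integral>\<^sup>+\<omega>. ennreal (?Y k \<omega>) \<partial>M)"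
        using nonneg[OF k] b by (intro nn_integral_eq_integral[symmetric] intY k) auto
      also have "\<dots> \<le> mean M (X k)"
        unfolding mean_def by (intro nn_integral_mono ennreal_leI) simp
      finally show "ennreal (expectation (?Y k)) \<le> mean M (X k)" .
    qed
    also note mean
    finally show ?thesis using \<open>\<mu> \<ge> 0\<close> by (simp add: ennreal_le_iff)
  qed
  define s where "s = ln (1 + x / n) / b"
  have s: "s > 0"
    using b x n unfolding s_def by (intro divide_pos_pos ln_gt_zero) auto
  have exp_sb: "exp (s * b) = 1 + x / n" using b x n by (simp add: s_def add_pos_pos)
  let ?A = "\<lambda>k. {\<omega> \<in> space M. X k \<omega> > b}" and ?B = "{\<omega> \<in> space M. (\<Sum>k=1..n. ?Y k \<omega>) \<ge> x}"
  have "prob ?B \<le> exp (- s * x) * exp ((exp (s * b) - 1) / b * (\<Sum>k=1..n. expectation (?Y k)))"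
    by (rule prob_bounded_sum_ge_le) (use indY nonneg b s in auto)
  also have "(exp (s * b) - 1) / b * (\<Sum>k=1..n. expectation (?Y k)) \<le> (exp (s * b) - 1) / b * (\<mu> * n)"
    using sum_mean b s by (intro mult_left_mono) auto
  also have "(exp (s * b) - 1) / b * (\<mu> * n) = q * \<mu>"
    unfolding exp_sb unfolding b_def using x q n by (simp add: field_simps)
  also have "exp (- s * x) \<le> (n / x) ^ q"
  proof -
    have "exp (- s * x) = inverse ((exp (s * b)) ^ q)"
      using q by (simp add: exp_minus b_def flip: exp_of_nat_mult)
    also have "\<dots> \<le> inverse ((x / n) ^ q)"
      unfolding exp_sb using x n by (intro le_imp_inverse_le power_mono) auto
    also have "\<dots> = (n / x) ^ q" by (simp add: power_divide)
    finally show ?thesis .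
  qed
  finally have B: "prob ?B \<le> exp (q * \<mu>) * (n / x) ^ q" by (simp add: mult.commute)
  have "{\<omega> \<in> space M. (\<Sum>k=1..n. X k \<omega>) > x} \<subseteq> (\<Union>k\<in>{1..n}. ?A k) \<union> ?B"
  proof
    fix \<omega> assume w: "\<omega> \<in> {\<omega> \<in> space M. (\<Sum>k=1..n. X k \<omega>) > x}"
    show "\<omega> \<in> (\<Union>k\<in>{1..n}. ?A k) \<union> ?B"
    proof (cases "\<exists>k\<in>{1..n}. X k \<omega> > b")
      case False
      then have "(\<Sum>k=1..n. ?Y k \<omega>) = (\<Sum>k=1..n. X k \<omega>)" by (intro sum.cong) (auto simp: not_less)
      with w show ?thesis by simp
    qed (use w in auto)
  qed
  then have "prob {\<omega> \<in> space M. (\<Sum>k=1..n. X k \<omega>) > x} \<le> prob ((\<Union>k\<in>{1..n}. ?A k) \<union> ?B)"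
    by (intro finite_measure_mono) auto
  also have "\<dots> \<le> prob (\<Union>k\<in>{1..n}. ?A k) + prob ?B"
    by (intro measure_Un_le) auto
  also have "prob (\<Union>k\<in>{1..n}. ?A k) \<le> (\<Sum>k=1..n. prob (?A k))"
    by (intro measure_UNION_le) auto
  also have "\<dots> = (\<Sum>k=1..n. tail (df M (X k)) (1 / q * x))"
    by (intro sum.cong) (auto simp: tail_df_eq_prob b_def)
  also note B
  finally show ?thesis unfolding tail_df_eq_prob[OF measS] by simp
qed

lemma (in prob_space) random_variable_partial_sum:
  assumes "\<And>k. k \<ge> 1 \<Longrightarrow> random_variable borel (\<xi> k)"
  shows "random_variable borel (partial_sum \<xi> n)"
proof -
  note [measurable] = assms
  show ?thesis unfolding partial_sum_def[abs_def] by measurable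
qed

lemma partial_sum_nonneg:
  assumes "\<And>k. k \<ge> 1 \<Longrightarrow> 0 \<le> \<xi> k \<omega>"
  shows "0 \<le> partial_sum \<xi> n \<omega>"
  unfolding partial_sum_def using assms by (intro sum_nonneg) auto

lemma (in prob_space) tail_partial_sum_0:
  assumes "x \<ge> 0"
  shows "tail (df M (partial_sum \<xi> 0)) x = 0"
  using assms by (subst tail_df_eq_prob) (simp_all add: partial_sum_def[abs_def])

lemma (in prob_space) partial_sum_scale_continuous:
  assumes indep: "indep_vars (\<lambda>_. borel) \<xi> {1..}"
    and nonneg: "\<And>k \<omega>. k \<ge> 1 \<Longrightarrow> \<omega> \<in> space M \<Longrightarrow> \<xi> k \<omega> \<ge> 0"
    and T: "antimono T" "\<And>x. T x > 0" "scale_continuous T T"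
    and sc: "\<And>k. k \<ge> 1 \<Longrightarrow> scale_continuous T (tail (df M (\<xi> k)))"
    and O: "\<And>k. k \<ge> 1 \<Longrightarrow> tail (df M (\<xi> k)) \<in> O[at_top](T)"
  shows "scale_continuous T (tail (df M (partial_sum \<xi> n))) \<and>
    tail (df M (partial_sum \<xi> n)) \<in> O[at_top](T)"
proof (induction n)
  case 0
  let ?G = "tail (df M (partial_sum \<xi> 0))"
  have S: "random_variable borel (partial_sum \<xi> 0)" by (simp add: partial_sum_def[abs_def])
  have ev: "\<forall>\<^sub>F x in at_top. ?G x = 0"
    by (rule eventually_mono[OF eventually_ge_at_top[of 0] tail_partial_sum_0])
  then have small: "?G \<in> o[at_top](T)"
    by (intro landau_o.small.in_cong[THEN iffD2, OF ev]) simp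
  show ?case
    by (rule conjI[OF scale_continuous_smallo[OF small tail_df_nonneg(1)[OF S] T(2,3)]
          landau_o.small_imp_big[OF small]])
next
  case (Suc n)
  have S_Suc: "partial_sum \<xi> (Suc n) = (\<lambda>\<omega>. \<xi> (Suc n) \<omega> + partial_sum \<xi> n \<omega>)"
    by (simp add: partial_sum_def fun_eq_iff add.commute)
  have "{1..Suc n} = insert (Suc n) {1..n}" by auto
  then have "indep_vars (\<lambda>_. borel) \<xi> (insert (Suc n) {1..n})"
    using indep_vars_subset[OF indep, of "{1..Suc n}"] by auto
  from indep_vars_sum[OF _ _ this]
  have ind: "indep_var borel (\<xi> (Suc n)) borel (partial_sum \<xi> n)"
    by (simp add: partial_sum_def[abs_def])
  have k: "Suc n \<ge> 1" by simp
  have S_nonneg: "0 \<le> partial_sum \<xi> n \<omega>" if "\<omega> \<in> space M" for \<omega>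
    using nonneg that by (intro partial_sum_nonneg) auto
  note add = scale_continuous_add_tail[OF prob_space_axioms ind nonneg[OF k] S_nonneg T(2)
      scale_continuous_imp_bigo_scaled[OF T] O[OF k] conjunct2[OF Suc] sc[OF k] conjunct1[OF Suc]]
  show ?case unfolding S_Suc by (rule conjI[OF add])
qed

text \<open>
  The bound is uniform in \<open>n\<close>. For \<open>n \<ge> x\<close> it holds because the last term is then at least 1; for \<open>n < x\<close> it is
  the truncation bound combined with the averaged bound on the tails of the summands.
\<close>

lemma (in prob_space) partial_sum_tail_uniform_bound:
  assumes indep: "indep_vars (\<lambda>_. borel) \<xi> {1..}"
    and nonneg: "\<And>k \<omega>. k \<ge> 1 \<Longrightarrow> \<omega> \<in> space M \<Longrightarrow> \<xi> k \<omega> \<ge> 0"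
    and mean: "\<forall>n\<ge>1. (\<Sum>k=1..n. mean M (\<xi> k)) \<le> ennreal (\<mu> * real n)" "\<mu> \<ge> 0"
    and tails: "\<forall>\<^sub>F x in at_top. \<forall>n\<ge>1. (\<Sum>k=1..n. tail (df M (\<xi> k)) x) \<le> C * real n * T x" "C > 0"
    and T: "\<And>x. T x > 0" "\<forall>\<^sub>F x in at_top. T (1 / q * x) \<le> D * T x" "D > 0"
    and q: "q \<ge> 1"
  shows "\<forall>\<^sub>F x in at_top. \<forall>n. tail (df M (partial_sum \<xi> n)) x \<le>
    C * D * T x * real n + exp (q * \<mu>) * min 1 (real n / x) ^ q"
proof -
  have \<xi>: "random_variable borel (\<xi> k)" if "k \<ge> 1" for k
    using indep that by (auto simp: indep_vars_def)
  have S: "random_variable borel (partial_sum \<xi> n)" for n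
    using \<xi> by (rule random_variable_partial_sum)
  have "filterlim (\<lambda>x::real. 1 / q * x) at_top at_top"
    using q by (intro filterlim_tendsto_pos_mult_at_top[OF tendsto_const] filterlim_ident) simp
  from eventually_compose_filterlim[OF tails(1) this] T(2) eventually_gt_at_top[of 0]
  show ?thesis
  proof eventually_elim
    case (elim x)
    show ?case
    proof
      fix n
      let ?G = "tail (df M (partial_sum \<xi> n))"
      consider "n = 0" | "n \<ge> 1" "n \<ge> x" | "n \<ge> 1" "n < x" by force
      then show "?G x \<le> C * D * T x * real n + exp (q * \<mu>) * min 1 (real n / x) ^ q"
      proof cases
        case 1
        then show ?thesis using elim q tail_partial_sum_0[of x \<xi>] by (simp add: zero_power)
      next
        case 2
        then have "min 1 (n / x) = 1" using elim by simp
        have "?G x \<le> 1" by (rule tail_df_nonneg(2)[OF S])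
        moreover have "0 \<le> C * D * T x * n" using \<open>C > 0\<close> \<open>D > 0\<close> T(1)[of x] by simp
        moreover have "1 \<le> exp (q * \<mu>)" using \<open>\<mu> \<ge> 0\<close> by simp
        ultimately have "?G x \<le> C * D * T x * n + exp (q * \<mu>)" by linarith
        with \<open>min 1 (n / x) = 1\<close> show ?thesis by simp
      next
        case 3
        have ind: "indep_vars (\<lambda>_. borel) \<xi> {1..n}" by (rule indep_vars_subset[OF indep]) auto
        have "?G x \<le> (\<Sum>k=1..n. tail (df M (\<xi> k)) (1 / q * x)) + exp (q * \<mu>) * (n / x) ^ q"
          unfolding partial_sum_def[abs_def]
          by (rule tail_sum_le_tails_plus_power[OF prob_space_axioms ind])
            (use nonneg mean q 3 elim in auto)
        also have "(\<Sum>k=1..n. tail (df M (\<xi> k)) (1 / q * x)) \<le> C * n * T (1 / q * x)"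
          using elim 3 by blast
        also have "\<dots> \<le> C * n * (D * T x)" using elim \<open>C > 0\<close> by (intro mult_left_mono) auto
        also have "\<dots> = C * D * T x * n" by simp
        also have "n / x = min 1 (n / x)" using 3 elim by simp
        finally show ?thesis by simp
      qed
    qed
  qed
qed

section \<open>Mixtures with negligible mixing tail\<close>

lemma summable_if_gt:
  fixes p :: "nat \<Rightarrow> real"
  assumes "\<And>n. 0 \<le> p n" "summable p"
  shows "summable (\<lambda>n. if real n > t then p n else 0)"
proof (rule summable_comparison_test')
  show "summable p" by fact
qed (use assms in auto)

text \<open>
  The mean of a distribution \<open>p\<close> on the natural numbers is the sum of its tails: write the factor
  \<open>n\<close> as the number of \<open>t < n\<close> and exchange the order of summation.
\<close>

lemma summable_index_times_of_tail_sums: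
  fixes p :: "nat \<Rightarrow> real"
  assumes p: "\<And>n. 0 \<le> p n" "summable p"
    and sum: "summable (\<lambda>t. \<Sum>n. if real n > real t then p n else 0)"
  shows "summable (\<lambda>n. real n * p n)"
proof (rule summableI_nonneg_bounded)
  fix N
  have "(\<Sum>n<N. real n * p n) = (\<Sum>n<N. \<Sum>t<N. if n > t then p n else 0)"
  proof (rule sum.cong)
    fix n assume "n \<in> {..<N}"
    then have "{..<N} \<inter> {t. t < n} = {..<n}" by auto
    then show "real n * p n = (\<Sum>t<N. if n > t then p n else 0)"
      by (simp add: sum.If_cases)
  qed simp
  also have "\<dots> = (\<Sum>t<N. \<Sum>n<N. if n > t then p n else 0)" by (rule sum.swap)
  also have "\<dots> \<le> (\<Sum>t<N. \<Sum>n. if real n > real t then p n else 0)"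
  proof (rule sum_mono)
    fix t
    have "(\<Sum>n<N. if real n > real t then p n else 0) \<le> (\<Sum>n. if real n > real t then p n else 0)"
      by (rule sum_le_suminf) (use p summable_if_gt[OF p, of "real t"] in auto)
    then show "(\<Sum>n<N. if n > t then p n else 0) \<le> (\<Sum>n. if real n > real t then p n else 0)"
      by simp
  qed
  also have "\<dots> \<le> (\<Sum>t. \<Sum>n. if real n > real t then p n else 0)"
    by (rule sum_le_suminf) (use p sum in \<open>auto intro!: suminf_nonneg summable_if_gt simp del: of_nat_less_iff\<close>)
  finally show "(\<Sum>n<N. real n * p n) \<le> (\<Sum>t. \<Sum>n. if real n > real t then p n else 0)" .
qed (use p in auto)

text \<open>
  If the tail of \<open>p\<close> is negligible against \<open>T\<close>, then so is the truncated moment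
  \<open>A K x = (\<Sum>n\<ge>K. p n * min 1 (n / x) ^ q)\<close> of a sufficiently high order \<open>q\<close>. Halving \<open>x\<close> gains a factor
  \<open>2 ^ q\<close> on the indices below \<open>x / 2\<close>, so that \<open>A K x \<le> A K (x / 2) / 2 ^ q + H (x / 2)\<close> for the tail \<open>H\<close>
  of \<open>p\<close>, whereas it costs at most the factor \<open>D\<close> in \<open>T\<close>. When \<open>2 ^ q \<ge> 2 D\<close>, an inequality
  \<open>A K x \<le> \<epsilon> T x\<close> therefore propagates from \<open>[x0, 2 x0]\<close> to all larger \<open>x\<close>. On this first interval
  it holds once \<open>K\<close> is large, because \<open>A K x\<close> is at most the remainder of \<open>p\<close> from \<open>K\<close> on.
\<close>

lemma truncated_moment_le_tail:
  fixes p :: "nat \<Rightarrow> real" and T :: "real \<Rightarrow> real"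
  assumes p: "\<And>n. 0 \<le> p n" "summable p"
    and T: "antimono T" "\<And>x. T x > 0"
    and doubling: "\<forall>\<^sub>F x in at_top. T (1 / 2 * x) \<le> D * T x" and D: "D > 0" "2 * D \<le> 2 ^ q"
    and small: "(\<lambda>t. \<Sum>n. if real n > t then p n else 0) \<in> o[at_top](T)" and "\<epsilon> > 0"
  shows "\<exists>N. \<forall>K\<ge>N. \<forall>\<^sub>F x in at_top. (\<Sum>i. p (i + K) * min 1 (real (i + K) / x) ^ q) \<le> \<epsilon> * T x"
proof -
  define H where "H t = (\<Sum>n. if real n > t then p n else 0)" for t
  define A where "A K x = (\<Sum>i. p (i + K) * min 1 (real (i + K) / x) ^ q)" for K x
  have summ: "summable (\<lambda>n. if real n > t then p n else 0)" for t by (rule summable_if_gt[OF p])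
  have min_pow: "0 \<le> min 1 (real n / x) ^ q" "min 1 (real n / x) ^ q \<le> 1" if "x > 0" for n x
    using that by (auto intro!: power_le_one)
  have summA: "summable (\<lambda>i. p (i + K) * min 1 (real (i + K) / x) ^ q)" if "x > 0" for K x
  proof (rule summable_comparison_test')
    show "summable (\<lambda>i. p (i + K))" using p(2) by (rule summable_ignore_initial_segment)
    show "norm (p (i + K) * min 1 (real (i + K) / x) ^ q) \<le> p (i + K)" for i
      using min_pow[OF that, of "i + K"] p(1)[of "i + K"] mult_left_le by (auto simp: abs_mult)
  qed
  have A_le: "A K x \<le> (\<Sum>i. p (i + K))" if "x > 0" for K x
    unfolding A_def
    by (intro suminf_le mult_left_le min_pow(2) that p summA summable_ignore_initial_segment)
  have rec: "A K x \<le> (1 / 2) ^ q * A K (1 / 2 * x) + H (1 / 2 * x)" if "x > 0" for K x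
  proof -
    let ?t = "\<lambda>n. if real n > 1 / 2 * x then p n else 0"
    have x2: "1 / 2 * x > 0" using that by simp
    have summt: "summable (\<lambda>i. ?t (i + K))" by (rule summable_ignore_initial_segment[OF summ])
    have "A K x \<le> (\<Sum>i. (1 / 2) ^ q * (p (i + K) * min 1 (real (i + K) / (1 / 2 * x)) ^ q) + ?t (i + K))"
      unfolding A_def
    proof (rule suminf_le)
      fix i
      let ?n = "i + K"
      show "p ?n * min 1 (real ?n / x) ^ q \<le> (1 / 2) ^ q * (p ?n * min 1 (real ?n / (1 / 2 * x)) ^ q) + ?t ?n"
      proof (cases "real ?n > 1 / 2 * x")
        case True
        have "p ?n * min 1 (real ?n / x) ^ q \<le> p ?n"
          by (intro mult_left_le min_pow(2)[OF that] p(1))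
        moreover have "0 \<le> (1 / 2) ^ q * (p ?n * min 1 (real ?n / (1 / 2 * x)) ^ q)"
          by (intro mult_nonneg_nonneg min_pow(1)[OF x2] p(1)) simp
        ultimately show ?thesis using True by simp
      next
        case False
        then have "min 1 (real ?n / x) = 1 / 2 * min 1 (real ?n / (1 / 2 * x))"
          using that by (simp add: min_def field_simps)
        then show ?thesis using False by (simp only: power_mult_distrib) simp
      qed
    next
      show "summable (\<lambda>i. (1 / 2) ^ q * (p (i + K) * min 1 (real (i + K) / (1 / 2 * x)) ^ q) + ?t (i + K))"
        by (rule summable_add[OF summable_mult[OF summA[OF x2]] summt])
    qed (rule summA[OF that])
    also have "\<dots> = (1 / 2) ^ q * A K (1 / 2 * x) + (\<Sum>i. ?t (i + K))"
      unfolding A_def by (subst suminf_add[symmetric])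
        (use summA[OF x2] summt in \<open>auto intro: summable_mult simp: suminf_mult\<close>)
    also have "(\<Sum>i. ?t (i + K)) \<le> H (1 / 2 * x)"
      unfolding H_def suminf_minus_initial_segment[OF summ]
      using p(1) by (simp add: sum_nonneg)
    finally show ?thesis by simp
  qed
  have scale: "filterlim (\<lambda>x::real. 1 / 2 * x) at_top at_top"
    by (intro filterlim_tendsto_pos_mult_at_top[OF tendsto_const] filterlim_ident) simp
  \<comment> \<open>half of \<open>\<epsilon>\<close> is reserved for the tail of \<open>p\<close>, and doubling costs the factor \<open>D\<close>\<close>
  have e': "\<epsilon> / (2 * D) > 0" using \<open>\<epsilon> > 0\<close> D by simp
  have "\<forall>\<^sub>F x in at_top. norm (H x) \<le> \<epsilon> / (2 * D) * norm (T x)"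
    using landau_o.smallD[OF small e'] by (simp add: H_def)
  from eventually_compose_filterlim[OF this scale] doubling eventually_gt_at_top[of 0]
  have "\<forall>\<^sub>F x in at_top. x > 0 \<and> T (1 / 2 * x) \<le> D * T x \<and> H (1 / 2 * x) \<le> \<epsilon> / 2 * T x"
  proof eventually_elim
    case (elim x)
    have "H (1 / 2 * x) \<le> \<epsilon> / (2 * D) * T (1 / 2 * x)" using elim(1) T(2)[of "1 / 2 * x"] by simp
    also have "\<dots> \<le> \<epsilon> / (2 * D) * (D * T x)" using elim e' by (intro mult_left_mono) auto
    finally show ?case using elim D by simp
  qed
  then obtain x0 where x0: "\<And>x. x \<ge> x0 \<Longrightarrow> x > 0 \<and> T (1 / 2 * x) \<le> D * T x \<and> H (1 / 2 * x) \<le> \<epsilon> / 2 * T x"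
    by (auto simp: eventually_at_top_linorder)
  then have "x0 > 0" by blast
  obtain N where N: "\<And>K. K \<ge> N \<Longrightarrow> norm (\<Sum>i. p (i + K)) < \<epsilon> * T (2 * x0)"
    using suminf_exist_split[OF _ p(2), of "\<epsilon> * T (2 * x0)"] \<open>\<epsilon> > 0\<close> T(2) by auto
  have main: "A K x \<le> \<epsilon> * T x" if "K \<ge> N" "x0 \<le> x" "x \<le> 2 ^ Suc m * x0" for K x m
    using that(2,3)
  proof (induction m arbitrary: x)
    case 0
    have "A K x \<le> (\<Sum>i. p (i + K))" using x0[OF 0(1)] by (intro A_le) simp
    also have "\<dots> \<le> \<epsilon> * T (2 * x0)" using N[OF \<open>K \<ge> N\<close>] by simp
    also have "\<dots> \<le> \<epsilon> * T x"
      using antimonoD[OF T(1), of x "2 * x0"] 0 \<open>\<epsilon> > 0\<close> by (intro mult_left_mono) auto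
    finally show ?case .
  next
    case (Suc m)
    show ?case
    proof (cases "x \<le> 2 ^ Suc m * x0")
      case True
      then show ?thesis using Suc by blast
    next
      case False
      have "1 * x0 \<le> 2 ^ m * x0" using \<open>x0 > 0\<close> by (intro mult_right_mono) auto
      then have half: "x0 \<le> 1 / 2 * x" "1 / 2 * x \<le> 2 ^ Suc m * x0" using False Suc.prems by auto
      have "A K x \<le> (1 / 2) ^ q * A K (1 / 2 * x) + H (1 / 2 * x)"
        using x0[OF Suc.prems(1)] by (intro rec) simp
      also have "A K (1 / 2 * x) \<le> \<epsilon> * T (1 / 2 * x)" by (rule Suc.IH[OF half])
      also have "T (1 / 2 * x) \<le> D * T x" using x0[OF Suc.prems(1)] by simp
      also have "H (1 / 2 * x) \<le> \<epsilon> / 2 * T x" using x0[OF Suc.prems(1)] by simp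
      also have "(1 / 2) ^ q * (\<epsilon> * (D * T x)) = (1 / 2) ^ q * D * (\<epsilon> * T x)" by simp
      also have "(1 / 2) ^ q * D \<le> 1 / 2" using D by (simp add: power_divide field_simps)
      finally show ?thesis using \<open>\<epsilon> > 0\<close> T(2)[of x] by simp
    qed
  qed
  have "\<forall>\<^sub>F x in at_top. A K x \<le> \<epsilon> * T x" if "K \<ge> N" for K
    using eventually_ge_at_top[of x0]
  proof eventually_elim
    case (elim x)
    obtain m where "x / x0 < 2 ^ m" using real_arch_pow[of 2 "x / x0"] by auto
    then have "x < 2 ^ m * x0" using \<open>x0 > 0\<close> by (simp add: field_simps)
    also have "\<dots> \<le> 2 ^ Suc m * x0" using \<open>x0 > 0\<close> by simp
    finally show ?case using main[OF that elim, of m] by simp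
  qed
  then show ?thesis unfolding A_def by blast
qed

text \<open>
  The remainder of the mixture is split along the assumed bound on \<open>g n\<close>: the linear part is controlled
  by the convergence of the mean of \<open>p\<close>, the power part by the truncated moments.
\<close>

lemma mixture_remainder_negligible:
  fixes p :: "nat \<Rightarrow> real" and g :: "nat \<Rightarrow> real \<Rightarrow> real" and T :: "real \<Rightarrow> real"
  assumes p: "\<And>n. 0 \<le> p n" "summable p" and mean: "summable (\<lambda>n. real n * p n)"
    and T: "antimono T" "\<And>x. T x > 0"
    and doubling: "\<forall>\<^sub>F x in at_top. T (1 / 2 * x) \<le> D * T x" "D > 0" "2 * D \<le> 2 ^ q"
    and small: "(\<lambda>t. \<Sum>n. if real n > t then p n else 0) \<in> o[at_top](T)"
    and g_nonneg: "\<And>n x. 0 \<le> g n x"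
    and g_le: "\<forall>\<^sub>F x in at_top. \<forall>n. g n x \<le> A * T x * real n + B * min 1 (real n / x) ^ q"
    and AB: "A > 0" "B > 0" and "\<epsilon> > 0"
  shows "\<exists>K. \<forall>\<^sub>F x in at_top. (\<Sum>i. p (i + K) * g (i + K) x) \<le> \<epsilon> * T x"
proof -
  have e1: "\<epsilon> / (2 * B) > 0" and e2: "\<epsilon> / (2 * A) > 0" using AB \<open>\<epsilon> > 0\<close> by simp_all
  obtain N1 where N1: "\<And>K. K \<ge> N1 \<Longrightarrow> \<forall>\<^sub>F x in at_top.
      (\<Sum>i. p (i + K) * min 1 (real (i + K) / x) ^ q) \<le> \<epsilon> / (2 * B) * T x"
    using truncated_moment_le_tail[OF p T doubling small e1] by blast
  obtain N2 where N2: "\<And>K. K \<ge> N2 \<Longrightarrow> norm (\<Sum>i. real (i + K) * p (i + K)) < \<epsilon> / (2 * A)"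
    using suminf_exist_split[OF e2 mean] by blast
  define K where "K = max N1 N2"
  have mean_K: "(\<Sum>i. real (i + K) * p (i + K)) \<le> \<epsilon> / (2 * A)"
    using N2[of K] by (simp add: K_def del: of_nat_add)
  have "\<forall>\<^sub>F x in at_top. (\<Sum>i. p (i + K) * min 1 (real (i + K) / x) ^ q) \<le> \<epsilon> / (2 * B) * T x"
    by (rule N1) (simp add: K_def)
  with g_le eventually_gt_at_top[of 0]
  have "\<forall>\<^sub>F x in at_top. (\<Sum>i. p (i + K) * g (i + K) x) \<le> \<epsilon> * T x"
  proof eventually_elim
    case (elim x)
    let ?a = "\<lambda>i. real (i + K) * p (i + K)" and ?b = "\<lambda>i. p (i + K) * min 1 (real (i + K) / x) ^ q"
    have sum_a: "summable ?a" by (rule summable_ignore_initial_segment[OF mean])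
    have sum_p: "summable (\<lambda>i. p (i + K))" by (rule summable_ignore_initial_segment[OF p(2)])
    have pow: "0 \<le> min 1 (real n / x) ^ q" "min 1 (real n / x) ^ q \<le> 1" for n
      using elim(2) by (auto intro!: power_le_one)
    have sum_b: "summable ?b"
    proof (rule summable_comparison_test'[OF sum_p])
      show "norm (?b i) \<le> p (i + K)" for i
        unfolding real_norm_def abs_mult abs_of_nonneg[OF p(1)] abs_of_nonneg[OF pow(1)]
        by (intro mult_left_le pow(2) p(1))
    qed
    have sum_ab: "summable (\<lambda>i. A * T x * ?a i + B * ?b i)"
      by (intro summable_add summable_mult sum_a sum_b)
    have le: "p (i + K) * g (i + K) x \<le> A * T x * ?a i + B * ?b i" for i
    proof -
      have "p (i + K) * g (i + K) x \<le>
          p (i + K) * (A * T x * real (i + K) + B * min 1 (real (i + K) / x) ^ q)"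
        using elim(1) by (intro mult_left_mono p(1)) blast
      then show ?thesis by (simp add: algebra_simps del: of_nat_add)
    qed
    have "(\<Sum>i. p (i + K) * g (i + K) x) \<le> (\<Sum>i. A * T x * ?a i + B * ?b i)"
    proof (rule suminf_le[OF le _ sum_ab])
      show "summable (\<lambda>i. p (i + K) * g (i + K) x)"
      proof (rule summable_comparison_test'[OF sum_ab])
        show "norm (p (i + K) * g (i + K) x) \<le> A * T x * ?a i + B * ?b i" for i
          using le[of i] mult_nonneg_nonneg[OF p(1) g_nonneg, of "i + K" "i + K" x] by simp
      qed
    qed
    also have "\<dots> = (\<Sum>i. A * T x * ?a i) + (\<Sum>i. B * ?b i)"
      by (rule suminf_add[symmetric, OF summable_mult[OF sum_a] summable_mult[OF sum_b]])
    also have "\<dots> = A * T x * (\<Sum>i. ?a i) + B * (\<Sum>i. ?b i)"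
      by (simp only: suminf_mult[OF sum_a] suminf_mult[OF sum_b])
    also have "\<dots> \<le> A * T x * (\<epsilon> / (2 * A)) + B * (\<epsilon> / (2 * B) * T x)"
      using mean_K elim(3) AB T(2)[of x] by (intro add_mono mult_left_mono) auto
    also have "\<dots> = \<epsilon> * T x" using AB by (simp add: field_simps)
    finally show ?case .
  qed
  then show ?thesis by blast
qed

text \<open>
  Up to an error \<open>\<epsilon> h\<close> only finitely many \<open>g n\<close> matter, and for these a common range of \<open>y\<close> can be chosen.
\<close>

lemma scale_continuous_mixture:
  fixes p :: "nat \<Rightarrow> real" and g :: "nat \<Rightarrow> real \<Rightarrow> real"
  assumes p: "\<And>n. 0 \<le> p n" "p sums 1"
    and g: "\<And>n x. 0 \<le> g n x" "\<And>n x. g n x \<le> 1"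
    and sc: "\<And>n. scale_continuous h (g n)"
    and h: "\<And>x. h x > 0" "scale_continuous h h"
    and rest: "\<And>\<epsilon>. \<epsilon> > 0 \<Longrightarrow> \<exists>K. \<forall>\<^sub>F x in at_top. (\<Sum>i. p (i + K) * g (i + K) x) \<le> \<epsilon> * h x"
  shows "scale_continuous h (\<lambda>x. \<Sum>n. p n * g n x)"
  unfolding scale_continuous_def
proof (intro allI impI)
  fix \<epsilon> :: real assume "\<epsilon> > 0"
  define e where "e = \<epsilon> / 4"
  have "e > 0" using \<open>\<epsilon> > 0\<close> by (simp add: e_def)
  have summ: "summable (\<lambda>n. p n * g n x)" for x
  proof (rule summable_comparison_test')
    show "summable p" using p(2) by (rule sums_summable)
    show "norm (p n * g n x) \<le> p n" for n using p(1) g mult_left_le[of "g n x" "p n"] by simp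
  qed
  have split: "(\<Sum>n. p n * g n x) = (\<Sum>i. p (i + K) * g (i + K) x) + (\<Sum>n<K. p n * g n x)" for K x
    using suminf_split_initial_segment[OF summ] .
  obtain K where K: "\<forall>\<^sub>F x in at_top. (\<Sum>i. p (i + K) * g (i + K) x) \<le> e * h x"
    using rest[OF \<open>e > 0\<close>] by blast
  have "\<forall>\<^sub>F y in at_left 1. \<forall>n\<in>{..<K}. \<forall>\<^sub>F x in at_top. g n (x * y) \<le> g n x + e * h x"
    using sc \<open>e > 0\<close> by (intro eventually_ball_finite) (auto simp: scale_continuous_def)
  moreover have "\<forall>\<^sub>F y in at_left 1. \<forall>\<^sub>F x in at_top. h (x * y) \<le> h x + 1 * h x"
    using h(2) unfolding scale_continuous_def using zero_less_one by blast
  ultimately show "\<forall>\<^sub>F y in at_left 1. \<forall>\<^sub>F x in at_top.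
      (\<Sum>n. p n * g n (x * y)) \<le> (\<Sum>n. p n * g n x) + \<epsilon> * h x"
    using eventually_at_left_1_Ioo
  proof eventually_elim
    case (elim y)
    have "filterlim (\<lambda>x. x * y) at_top at_top"
      using elim by (intro filterlim_at_top_mult_tendsto_pos[OF tendsto_const] filterlim_ident) simp
    from eventually_compose_filterlim[OF K this] elim(2)
      eventually_ball_finite[OF finite_lessThan elim(1)]
    show ?case
    proof eventually_elim
      case (elim x)
      have "(\<Sum>n<K. p n * g n (x * y)) \<le> (\<Sum>n<K. p n * (g n x + e * h x))"
        using elim(3) p(1) by (intro sum_mono mult_left_mono) auto
      also have "\<dots> = (\<Sum>n<K. p n * g n x) + (\<Sum>n<K. p n) * (e * h x)"
        by (simp add: distrib_left sum.distrib sum_distrib_right)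
      also have "(\<Sum>n<K. p n) * (e * h x) \<le> 1 * (e * h x)"
        using sum_le_suminf[OF sums_summable[OF p(2)], of "{..<K}"] p(1) sums_unique[OF p(2)]
          \<open>e > 0\<close> h(1)[of x] by (intro mult_right_mono) auto
      finally have 1: "(\<Sum>n<K. p n * g n (x * y)) \<le> (\<Sum>n<K. p n * g n x) + e * h x" by simp
      have "(\<Sum>i. p (i + K) * g (i + K) (x * y)) \<le> e * (h x + 1 * h x)"
        using elim(1,2) \<open>e > 0\<close> by (meson mult_left_mono less_imp_le order_trans)
      moreover have "0 \<le> (\<Sum>i. p (i + K) * g (i + K) x)"
        using p g by (intro suminf_nonneg summable_ignore_initial_segment[OF summ]) auto
      moreover have "e * h x > 0" using \<open>e > 0\<close> h(1) by simp
      ultimately show ?case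
        using 1 unfolding split[of "x * y" K] split[of x K]
        by (simp add: e_def algebra_simps)
    qed
  qed
qed

section \<open>Averaged bounds and finite means\<close>

text \<open>
  A level \<open>u\<close> beyond which the supremum is below 1 bounds the large terms among \<open>a 1, ..., a n\<close> by \<open>n\<close>
  in total; the remaining terms are below \<open>u\<close> each.
\<close>

lemma linear_bound_of_mean_condition:
  fixes a :: "nat \<Rightarrow> ennreal"
  assumes "Limsup at_top (\<lambda>u::real. SUP n\<in>{1::nat..}.
    (\<Sum>k | k \<in> {1..n} \<and> a k \<ge> ennreal u. a k) / of_nat n) = 0"
  obtains \<mu> :: real where "\<mu> \<ge> 0" "\<forall>n\<ge>1. (\<Sum>k=1..n. a k) \<le> ennreal (\<mu> * real n)"
proof -
  have "Limsup at_top (\<lambda>u::real. SUP n\<in>{1::nat..}.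
    (\<Sum>k | k \<in> {1..n} \<and> a k \<ge> ennreal u. a k) / of_nat n) < 1"
    unfolding assms by simp
  from eventually_conj[OF Limsup_lessD[OF this] eventually_ge_at_top[of 0]]
  obtain u :: real where u: "u \<ge> 0"
    and sup: "(SUP n\<in>{1::nat..}. (\<Sum>k | k \<in> {1..n} \<and> a k \<ge> ennreal u. a k) / of_nat n) < 1"
    unfolding eventually_at_top_linorder by blast
  have "(\<Sum>k=1..n. a k) \<le> ennreal ((u + 1) * n)" if n: "n \<ge> 1" for n :: nat
  proof -
    let ?big = "\<Sum>k | k \<in> {1..n} \<and> a k \<ge> ennreal u. a k"
    have "?big / of_nat n < 1" using sup n by (meson SUP_upper atLeast_iff le_less_trans)
    then have big: "?big \<le> of_nat n"
      using n by (subst (asm) divide_less_ennreal) (auto simp: of_nat_less_top intro: less_imp_le)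
    have "(\<Sum>k=1..n. a k) \<le> (\<Sum>k=1..n. ennreal u + (if a k \<ge> ennreal u then a k else 0))"
      by (intro sum_mono) (auto intro: less_imp_le simp: not_le add_increasing)
    also have "\<dots> = of_nat n * ennreal u + ?big"
      by (simp add: sum.distrib sum.inter_filter[symmetric])
    also have "\<dots> \<le> of_nat n * ennreal u + of_nat n" using big by (intro add_left_mono)
    also have "\<dots> = ennreal ((u + 1) * n)"
      using u by (simp add: algebra_simps ennreal_plus ennreal_mult' ennreal_of_nat_eq_real_of_nat)
    finally show ?thesis .
  qed
  with u show ?thesis by (intro that[of "u + 1"]) auto
qed

lemma linear_bound_of_tail_condition:
  fixes t :: "nat \<Rightarrow> real \<Rightarrow> real" and T :: "real \<Rightarrow> real"
  assumes "Limsup at_top (\<lambda>x. SUP n\<in>{1::nat..}. ereal (1 / (real n * T x) * (\<Sum>i=1..n. t i x))) < \<infinity>"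
    and T: "\<And>x. T x > 0"
  obtains C where "C > 0" "\<forall>\<^sub>F x in at_top. \<forall>n\<ge>1. (\<Sum>i=1..n. t i x) \<le> C * real n * T x"
proof -
  obtain r where r: "Limsup at_top (\<lambda>x. SUP n\<in>{1::nat..}.
      ereal (1 / (real n * T x) * (\<Sum>i=1..n. t i x))) < ereal r"
    using assms(1) ereal_dense2 by blast
  have "\<forall>\<^sub>F x in at_top. \<forall>n\<ge>1. (\<Sum>i=1..n. t i x) \<le> max r 1 * real n * T x"
    using Limsup_lessD[OF r]
  proof eventually_elim
    case (elim x)
    show ?case
    proof (intro allI impI)
      fix n :: nat assume n: "n \<ge> 1"
      have "ereal (1 / (real n * T x) * (\<Sum>i=1..n. t i x)) \<le> ereal r"
        using elim n by (meson SUP_upper atLeast_iff less_imp_le order_trans)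
      then have "(\<Sum>i=1..n. t i x) \<le> r * (real n * T x)"
        using n T[of x] by (simp add: pos_divide_le_eq)
      also have "\<dots> \<le> max r 1 * (real n * T x)"
        using T[of x] by (intro mult_right_mono) auto
      finally show "(\<Sum>i=1..n. t i x) \<le> max r 1 * real n * T x" by (simp add: mult.assoc)
    qed
  qed
  then show ?thesis by (intro that[of "max r 1"]) auto
qed

text \<open>
  The integer part of \<open>X\<close> has mean \<open>\<Sum>t. P(t < floor X)\<close>, and its tails dominate those of \<open>X\<close> up to a
  shift of the argument by 1.
\<close>

lemma (in prob_space) summable_tail_df_of_mean_finite:
  assumes X[measurable]: "random_variable borel X" and "\<And>\<omega>. \<omega> \<in> space M \<Longrightarrow> 0 \<le> X \<omega>"
    and "mean M X < \<infinity>"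
  shows "summable (\<lambda>t. tail (df M X) (real t))"
proof -
  let ?T = "tail (df M X)"
  have "(\<Sum>t. ennreal (?T (real (Suc t)))) \<le> (\<Sum>t. emeasure M {\<omega> \<in> space M. t < nat \<lfloor>X \<omega>\<rfloor>})"
  proof (intro suminf_le summableI)
    fix t
    have "ennreal (?T (real (Suc t))) = emeasure M {\<omega> \<in> space M. X \<omega> > real (Suc t)}"
      by (simp add: tail_df_eq_prob emeasure_eq_measure)
    also have "\<dots> \<le> emeasure M {\<omega> \<in> space M. t < nat \<lfloor>X \<omega>\<rfloor>}"
    proof (rule emeasure_mono)
      show "{\<omega> \<in> space M. X \<omega> > real (Suc t)} \<subseteq> {\<omega> \<in> space M. t < nat \<lfloor>X \<omega>\<rfloor>}"
      proof safe
        fix \<omega> assume "X \<omega> > real (Suc t)"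
        then have "int (Suc t) \<le> \<lfloor>X \<omega>\<rfloor>" by (simp add: le_floor_iff)
        then show "t < nat \<lfloor>X \<omega>\<rfloor>" by linarith
      qed
    qed measurable
    finally show "ennreal (?T (real (Suc t))) \<le> emeasure M {\<omega> \<in> space M. t < nat \<lfloor>X \<omega>\<rfloor>}" .
  qed
  also have "\<dots> = (\<integral>\<^sup>+\<omega>. of_nat (nat \<lfloor>X \<omega>\<rfloor>) \<partial>M)"
    by (rule nn_integral_nat_function[symmetric]) measurable
  also have "\<dots> \<le> mean M X"
    unfolding mean_def
  proof (rule nn_integral_mono)
    fix \<omega> assume "\<omega> \<in> space M"
    then show "of_nat (nat \<lfloor>X \<omega>\<rfloor>) \<le> ennreal (X \<omega>)"
      using assms(2) by (simp add: ennreal_of_nat_eq_real_of_nat ennreal_leI)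
  qed
  also note \<open>mean M X < \<infinity>\<close>
  finally have "summable (\<lambda>t. ?T (real (Suc t)))"
    using tail_df_nonneg[OF X] by (intro summable_suminf_not_top) auto
  then show ?thesis by (subst (asm) summable_Suc_iff)
qed

section \<open>Randomly stopped sums\<close>

text \<open>
  Besides the tail of the stopped sum, this also covers events that depend on the index alone: there
  each \<open>B n\<close> is empty or the whole space.
\<close>

lemma (in prob_space) sums_prob_at_independent_index:
  assumes "indep_elements M (count_space UNIV) \<eta> N Z" and B: "\<And>n :: nat. B n \<in> sets N"
  shows "(\<lambda>n. prob {\<omega> \<in> space M. \<eta> \<omega> = n} * prob {\<omega> \<in> space M. Z \<omega> \<in> B n}) sums
    prob {\<omega> \<in> space M. Z \<omega> \<in> B (\<eta> \<omega>)}"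
proof -
  have [measurable]: "\<eta> \<in> measurable M (count_space UNIV)" "Z \<in> measurable M N"
    and ind: "indep_set {\<eta> -` A \<inter> space M | A. A \<in> sets (count_space UNIV)}
      {Z -` B \<inter> space M | B. B \<in> sets N}"
    using assms(1) by (auto simp: indep_elements_def)
  note [measurable] = B
  let ?A = "\<lambda>n. {\<omega> \<in> space M. \<eta> \<omega> = n} \<inter> {\<omega> \<in> space M. Z \<omega> \<in> B n}"
  have "(\<lambda>n. prob (?A n)) sums prob (\<Union>n. ?A n)"
    by (rule finite_measure_UNION) (auto simp: disjoint_family_on_def)
  also have "(\<Union>n. ?A n) = {\<omega> \<in> space M. Z \<omega> \<in> B (\<eta> \<omega>)}" by auto
  finally have sums: "(\<lambda>n. prob (?A n)) sums prob {\<omega> \<in> space M. Z \<omega> \<in> B (\<eta> \<omega>)}" .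
  have "prob (?A n) = prob {\<omega> \<in> space M. \<eta> \<omega> = n} * prob {\<omega> \<in> space M. Z \<omega> \<in> B n}" for n
  proof -
    have "\<eta> -` {n} \<inter> space M = {\<omega> \<in> space M. \<eta> \<omega> = n}" "Z -` B n \<inter> space M = {\<omega> \<in> space M. Z \<omega> \<in> B n}"
      by auto
    moreover have "prob ((\<eta> -` {n} \<inter> space M) \<inter> (Z -` B n \<inter> space M)) =
        prob (\<eta> -` {n} \<inter> space M) * prob (Z -` B n \<inter> space M)"
      using B[of n] by (intro indep_setD[OF ind]) auto
    ultimately show ?thesis by simp
  qed
  with sums show ?thesis by simp
qed

theorem theorem7:
  fixes M :: "'a measure" and \<xi> :: "nat \<Rightarrow> 'a \<Rightarrow> real" and \<eta> :: "'a \<Rightarrow> nat"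
  assumes "prob_space M"
    and indep: "prob_space.indep_vars M (\<lambda>_. borel) \<xi> {1..}"
    and nonneg: "\<And>k \<omega>. k \<ge> 1 \<Longrightarrow> \<omega> \<in> space M \<Longrightarrow> \<xi> k \<omega> \<ge> 0"
    and counting: "counting_rv M \<eta>"
    and indep_\<eta>: "indep_elements M (count_space UNIV) \<eta>
           (Pi\<^sub>M {1..} (\<lambda>_. borel)) (\<lambda>\<omega>. \<lambda>k\<in>{1..}. \<xi> k \<omega>)"
    and a: "df M (\<xi> 1) \<in> consistently_varying"
    and b: "\<And>k. k \<ge> 2 \<Longrightarrow> df M (\<xi> k) \<in> consistently_varying \<or>
           ((\<lambda>x. tail (df M (\<xi> k)) x / tail (df M (\<xi> 1)) x) \<longlongrightarrow> 0) at_top"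
    and c: "mean M (\<xi> 1) < \<infinity>"
    and d: "((\<lambda>x. tail (df M (\<lambda>\<omega>. real (\<eta> \<omega>))) x / tail (df M (\<xi> 1)) x) \<longlongrightarrow> 0) at_top"
    and e: "Limsup at_top (\<lambda>x. SUP n\<in>{1::nat..}.
           ereal (1 / (real n * tail (df M (\<xi> 1)) x) * (\<Sum>i=1..n. tail (df M (\<xi> i)) x))) < \<infinity>"
    and f: "Limsup at_top (\<lambda>u::real. SUP n\<in>{1::nat..}.
           (\<Sum>k | k \<in> {1..n} \<and> mean M (\<xi> k) \<ge> ennreal u. mean M (\<xi> k)) / of_nat n) = 0"
  shows "df M (stopped_sum \<xi> \<eta>) \<in> consistently_varying"
proof -
  interpret prob_space M by fact
  let ?Z = "\<lambda>\<omega>. \<lambda>k\<in>{1::nat..}. \<xi> k \<omega>"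
  let ?N = "Pi\<^sub>M {1..} (\<lambda>_. borel) :: (nat \<Rightarrow> real) measure"
  define F where "F k = tail (df M (\<xi> k))" for k
  define T where "T = F 1"
  define G where "G n = tail (df M (partial_sum \<xi> n))" for n
  define p where "p n = prob {\<omega> \<in> space M. \<eta> \<omega> = n}" for n

  have \<xi>[measurable]: "random_variable borel (\<xi> k)" if "k \<ge> 1" for k
    using indep that by (auto simp: indep_vars_def)
  have \<eta>[measurable]: "random_variable (count_space UNIV) \<eta>"
    using counting by (simp add: counting_rv_def)
  have S[measurable]: "random_variable borel (partial_sum \<xi> n)" for n
    using \<xi> by (rule random_variable_partial_sum)
  have Seta[measurable]: "random_variable borel (stopped_sum \<xi> \<eta>)"
    unfolding stopped_sum_def[abs_def] by measurable

  have T_pos: "T x > 0" for x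
    using a consistently_varying_iff[OF \<xi>, of 1] by (simp add: T_def F_def)
  have T_nz: "T x \<noteq> 0" for x using T_pos[of x] by simp
  have T_sc: "scale_continuous T T"
    using a consistently_varying_iff[OF \<xi>, of 1] by (simp add: T_def F_def)
  have T_anti: "antimono T" unfolding T_def F_def by (intro antimono_tail_df \<xi>) simp
  note T_scaled = scale_continuous_imp_bigo_scaled[OF T_anti T_pos T_sc]
  have F_nonneg: "0 \<le> F k x" if "k \<ge> 1" for k x
    unfolding F_def using tail_df_nonneg(1)[OF \<xi>[OF that]] .

  obtain C where "C > 0" and C: "\<forall>\<^sub>F x in at_top. \<forall>n\<ge>1. (\<Sum>i=1..n. F i x) \<le> C * real n * T x"
  proof (rule linear_bound_of_tail_condition)
    show "Limsup at_top (\<lambda>x. SUP n\<in>{1::nat..}.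
        ereal (1 / (real n * T x) * (\<Sum>i=1..n. F i x))) < \<infinity>"
      using e unfolding T_def F_def .
  qed (rule T_pos)
  obtain \<mu> :: real where "\<mu> \<ge> 0" and \<mu>: "\<forall>n\<ge>1. (\<Sum>k=1..n. mean M (\<xi> k)) \<le> ennreal (\<mu> * real n)"
    using f by (rule linear_bound_of_mean_condition)

  have F_bigo: "F k \<in> O[at_top](T)" if "k \<ge> 1" for k
  proof (rule bigoI)
    show "\<forall>\<^sub>F x in at_top. norm (F k x) \<le> C * real k * norm (T x)"
      using C
    proof eventually_elim
      case (elim x)
      have "F k x \<le> (\<Sum>i=1..k. F i x)" using that F_nonneg by (intro member_le_sum) auto
      also have "\<dots> \<le> C * real k * T x" using elim that by blast
      finally show ?case using F_nonneg[OF that, of x] T_pos[of x] by simp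
    qed
  qed
  \<comment> \<open>measured against \<open>T\<close>, both alternatives for a summand give the same property\<close>
  have F_sc: "scale_continuous T (F k)" if "k \<ge> 1" for k
  proof -
    consider "df M (\<xi> k) \<in> consistently_varying" | "((\<lambda>x. F k x / T x) \<longlongrightarrow> 0) at_top"
      using a b[of k] \<open>k \<ge> 1\<close> by (cases "k = 1") (auto simp: F_def T_def)
    then show ?thesis
    proof cases
      case 1
      then have "scale_continuous (F k) (F k)"
        using consistently_varying_iff[OF \<xi>[OF that]] by (simp add: F_def)
      then show ?thesis
        by (rule scale_continuous_bigo[OF _ F_bigo[OF that] F_nonneg[OF that] less_imp_le[OF T_pos]])
    next
      case 2
      have "F k \<in> o[at_top](T)" by (rule smalloI_tendsto[OF 2]) (simp add: T_nz)
      then show ?thesis by (rule scale_continuous_smallo[OF _ F_nonneg[OF that] T_pos T_sc])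
    qed
  qed

  have G_sc: "scale_continuous T (G n)" for n
    unfolding G_def
    by (rule conjunct1[OF partial_sum_scale_continuous[OF indep nonneg T_anti T_pos T_sc
            F_sc[unfolded F_def] F_bigo[unfolded F_def]]])
  have G_bounds: "0 \<le> G n x" "G n x \<le> 1" for n x
    unfolding G_def using tail_df_nonneg[OF S] by auto

  have Z_S: "partial_sum \<xi> n \<omega> = (\<Sum>k=1..n. ?Z \<omega> k)" for n \<omega>
    unfolding partial_sum_def by (intro sum.cong) auto
  have Z_space: "?Z \<omega> \<in> space ?N" for \<omega> by (simp add: space_PiM)
  have mixture: "(\<lambda>n. p n * G n x) sums tail (df M (stopped_sum \<xi> \<eta>)) x" for x
  proof -
    define B where "B n = {f \<in> space ?N. (\<Sum>k=1..n. f k) > x}" for n :: nat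
    have "B n \<in> sets ?N" for n unfolding B_def by measurable
    from sums_prob_at_independent_index[OF indep_\<eta> this] show ?thesis
      unfolding tail_df_eq_prob[OF Seta] G_def tail_df_eq_prob[OF S] p_def
      unfolding stopped_sum_def Z_S B_def using Z_space by simp
  qed
  have p_tail: "(\<lambda>n. if real n > t then p n else 0) sums tail (df M (\<lambda>\<omega>. real (\<eta> \<omega>))) t" for t
  proof -
    define B where "B n = (if real n > t then space ?N else {})" for n :: nat
    have "B n \<in> sets ?N" for n unfolding B_def by simp
    from sums_prob_at_independent_index[OF indep_\<eta> this]
    have "(\<lambda>n. p n * prob {\<omega> \<in> space M. ?Z \<omega> \<in> B n}) sums prob {\<omega> \<in> space M. ?Z \<omega> \<in> B (\<eta> \<omega>)}"
      unfolding p_def .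
    also have "(\<lambda>n. p n * prob {\<omega> \<in> space M. ?Z \<omega> \<in> B n}) = (\<lambda>n. if real n > t then p n else 0)"
      using Z_space by (auto simp: B_def fun_eq_iff prob_space)
    also have "{\<omega> \<in> space M. ?Z \<omega> \<in> B (\<eta> \<omega>)} = {\<omega> \<in> space M. real (\<eta> \<omega>) > t}"
      using Z_space by (auto simp: B_def)
    finally show ?thesis by (subst tail_df_eq_prob) simp_all
  qed
  have p_nonneg: "0 \<le> p n" for n by (simp add: p_def)
  have p_sums: "p sums 1"
    using p_tail[of "-1"] by (subst (asm) tail_df_eq_prob) (simp_all add: prob_space)
  note p_summable = sums_summable[OF p_sums]
  have H_eq: "(\<Sum>n. if real n > t then p n else 0) = tail (df M (\<lambda>\<omega>. real (\<eta> \<omega>))) t" for t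
    using sums_unique[OF p_tail] by simp
  have H_small: "(\<lambda>t. \<Sum>n. if real n > t then p n else 0) \<in> o[at_top](T)"
    unfolding H_eq
    by (rule smalloI_tendsto[OF d[folded F_def, folded T_def]]) (simp add: T_nz)
  \<comment> \<open>the stopping time inherits a finite mean from the first summand\<close>
  have mean_\<eta>: "summable (\<lambda>n. real n * p n)"
  proof (rule summable_index_times_of_tail_sums[OF p_nonneg p_summable])
    have T_summable: "summable (\<lambda>t. T (real t))"
      unfolding T_def F_def by (rule summable_tail_df_of_mean_finite[OF \<xi> nonneg c]) auto
    have "\<forall>\<^sub>F t in sequentially. norm (\<Sum>n. if real n > real t then p n else 0) \<le> 1 * norm (T (real t))"
      by (rule eventually_compose_filterlim[OF landau_o.smallD[OF H_small zero_less_one]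
            filterlim_real_sequentially])
    then have "\<forall>\<^sub>F t in sequentially. norm (\<Sum>n. if real n > real t then p n else 0) \<le> T (real t)"
      by eventually_elim (use T_pos in \<open>simp add: less_imp_le\<close>)
    from summable_comparison_test_ev[OF this T_summable]
    show "summable (\<lambda>t. \<Sum>n. if real n > real t then p n else 0)" .
  qed

  obtain D where "D > 0" and "\<forall>\<^sub>F x in at_top. norm (T (1 / 2 * x)) \<le> D * norm (T x)"
    using landau_o.bigE[OF T_scaled[of "1 / 2"]] by auto
  then have D: "\<forall>\<^sub>F x in at_top. T (1 / 2 * x) \<le> D * T x"
    using T_pos by (simp add: less_imp_le)
  \<comment> \<open>the order of the moments must beat the doubling constant, and truncation needs it to be at least 1\<close>
  obtain q :: nat where "2 * D < 2 ^ q" using real_arch_pow[of 2 "2 * D"] by auto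
  then have q: "2 * D \<le> 2 ^ max q 1"
    using power_increasing[of q "max q 1" "2::real"] by linarith
  define r where "r = max q 1"
  have r: "r \<ge> 1" "2 * D \<le> 2 ^ r" using q by (auto simp: r_def)
  obtain D' where "D' > 0" and "\<forall>\<^sub>F x in at_top. norm (T (1 / r * x)) \<le> D' * norm (T x)"
    using landau_o.bigE[OF T_scaled[of "1 / r"]] r by auto
  then have D': "\<forall>\<^sub>F x in at_top. T (1 / r * x) \<le> D' * T x"
    using T_pos by (simp add: less_imp_le)
  have G_le: "\<forall>\<^sub>F x in at_top. \<forall>n. G n x \<le>
      C * D' * T x * real n + exp (r * \<mu>) * min 1 (real n / x) ^ r"
    unfolding G_def
    by (rule partial_sum_tail_uniform_bound[OF indep nonneg \<mu> \<open>\<mu> \<ge> 0\<close> C[unfolded F_def] \<open>C > 0\<close>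
          T_pos D' \<open>D' > 0\<close> r(1)])

  have CD': "C * D' > 0" using \<open>C > 0\<close> \<open>D' > 0\<close> by simp
  have sc: "scale_continuous T (\<lambda>x. \<Sum>n. p n * G n x)"
    by (rule scale_continuous_mixture[OF p_nonneg p_sums G_bounds G_sc T_pos T_sc])
      (rule mixture_remainder_negligible[OF p_nonneg p_summable mean_\<eta> T_anti T_pos D \<open>D > 0\<close> r(2)
          H_small G_bounds(1) G_le CD' exp_gt_zero])

  let ?H = "tail (df M (stopped_sum \<xi> \<eta>))"
  have H_sums: "(\<lambda>x. \<Sum>n. p n * G n x) = ?H"
    using sums_unique[OF mixture] by (simp add: fun_eq_iff)
  \<comment> \<open>the stopped sum is at least as heavy as the first summand, up to the factor \<open>c0\<close>, so that
    continuity against \<open>T\<close> turns into continuity against the tail of the stopped sum itself\<close>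
  define c0 where "c0 = prob {\<omega> \<in> space M. real (\<eta> \<omega>) > 0}"
  have c0: "c0 > 0"
  proof -
    have "prob {\<omega> \<in> space M. \<not> \<eta> \<omega> = 0} = 1 - prob {\<omega> \<in> space M. \<eta> \<omega> = 0}"
      by (intro prob_neg) measurable
    then show ?thesis using counting by (simp add: counting_rv_def c0_def)
  qed
  have H_ge: "c0 * T x \<le> ?H x" for x
  proof -
    have lower: "(\<lambda>n. (if real n > 0 then p n else 0) * T x) sums (c0 * T x)"
      using sums_mult2[OF p_tail[of 0]] unfolding c0_def by (subst (asm) tail_df_eq_prob) simp_all
    have "(if real n > 0 then p n else 0) * T x \<le> p n * G n x" for n
    proof (cases "n = 0")
      case False
      have "\<xi> 1 \<omega> \<le> partial_sum \<xi> n \<omega>" if "\<omega> \<in> space M" for \<omega>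
        unfolding partial_sum_def using False that nonneg by (intro member_le_sum) auto
      then have "T x \<le> G n x"
        unfolding T_def F_def G_def tail_df_eq_prob[OF S] tail_df_eq_prob[OF \<xi>[OF order_refl]]
        by (intro finite_measure_mono) (auto intro: less_le_trans)
      then show ?thesis using False p_nonneg by (simp add: mult_left_mono)
    qed (use p_nonneg G_bounds in simp)
    from sums_le[OF this lower mixture] show ?thesis .
  qed
  have H_pos: "?H x > 0" for x
    using H_ge[of x] mult_pos_pos[OF c0 T_pos[of x]] by linarith
  have "T \<in> O[at_top](?H)"
  proof (rule bigoI[of _ "1 / c0"])
    show "\<forall>\<^sub>F x in at_top. norm (T x) \<le> 1 / c0 * norm (?H x)"
      using H_ge c0 T_pos H_pos by (intro always_eventually) (simp add: field_simps less_imp_le)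
  qed
  from scale_continuous_bigo[OF sc[unfolded H_sums] this less_imp_le[OF T_pos] less_imp_le[OF H_pos]]
  have "scale_continuous ?H ?H" .
  with H_pos show ?thesis using consistently_varying_iff[OF Seta] by blast
qed

end
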